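(* Let $G$ be a mixed graph with vertices $1,\dots,t$, and let $\mathcal A$ and $\mathcal B$ be two form representations of $G$, of dimensions $\underline n=(n_1,\dots,n_t)$ and $\underline m=(m_1,\dots,m_t)$ respectively. Then $\mathcal A$ and $\mathcal B$ are topologically isomorphic if and only if they are linearly isomorphic.
   Context: A mixed graph is a graph that may have both undirected and directed edges; multiple edges and loops are allowed. Let $G$ be a mixed graph with vertices $1,\dots,t$. A form representation $\mathcal A$ of $G$ of dimension $\underline n=(n_1,\dots,n_t)$ (a tuple of nonnegative integers) is given by assigning: - to each vertex $i$, the complex vector space $\mathbb C^{n_i}$ (with its usual topology); - to each undirected edge $\alpha$ between $i$ and $j$ (with $i\le j$), a bilinear form $A_\alpha:\mathbb C^{n_i}\times\mathbb C^{n_j}\to\mathbb C$; - to each directed edge $\beta$ from $i$ to $j$, a sesquilinear form $A_\beta:\mathbb C^{n_i}\times\mathbb C^{n_j}\to\mathbb C$ that is linear in the first argument and semilinear (conjugate linear) in the second. For a second form representation $\mathcal B$ of $G$, of dimension $\underline m=(m_1,\dots,m_t)$, the forms are denoted $B_\alpha$. Two form representations $\mathcal A$ and $\mathcal B$ of $G$ of dimensions $\underline n$ and $\underline m$ are topologically isomorphic (respectively, linearly isomorphic) if there exists a family of homeomorphisms (respectively, linear bijections) $$\varphi_1:\mathbb C^{n_1}\to\mathbb C^{m_1},\ \dots,\ \varphi_t:\mathbb C^{n_t}\to\mathbb C^{m_t}$$ such that $$A_\alpha(u,v)=B_\alpha(\varphi_i u,\varphi_j v)\qquad\text{for all } u\in\mathbb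 C^{n_i},\ v\in\mathbb C^{n_j},$$ for each edge $\alpha$ of $G$, whether undirected between $i$ and $j$ (with $i\le j$) or directed from $i$ to $j$. A homeomorphism is a continuous bijection whose inverse is also continuous; the maps $\varphi_i$ in the topological case are not assumed linear. *)

theory Defs
  imports "HOL-Analysis.Analysis"
begin

text \<open>
  The space \<open>\<complex>\<^sup>n\<close>, for a natural number \<open>n\<close>, possibly zero, consists of the sequences whose entries
  vanish from index \<open>n\<close> on. This is the complex analogue of \<^const>\<open>Euclidean_space\<close>: the topology
  is the one inherited from the product topology, that is, the usual topology of \<open>\<complex>\<^sup>n\<close>.
\<close>

type_synonym cvec = "nat \<Rightarrow> complex"

definition cvecs :: "nat \<Rightarrow> cvec set" where
  "cvecs n = {x. \<forall>i\<ge>n. x i = 0}"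

definition cspace :: "nat \<Rightarrow> cvec topology" where
  "cspace n = subtopology (product_topology (\<lambda>_. euclidean) UNIV) (cvecs n)"

lemma topspace_cspace [simp]: "topspace (cspace n) = cvecs n"
  by (simp add: cspace_def)

definition vadd :: "cvec \<Rightarrow> cvec \<Rightarrow> cvec" where
  "vadd x y = (\<lambda>i. x i + y i)"

definition vscale :: "complex \<Rightarrow> cvec \<Rightarrow> cvec" where
  "vscale c x = (\<lambda>i. c * x i)"

definition linear_functional :: "nat \<Rightarrow> (cvec \<Rightarrow> complex) \<Rightarrow> bool" where
  "linear_functional n f \<longleftrightarrow>
     (\<forall>x\<in>cvecs n. \<forall>y\<in>cvecs n. f (vadd x y) = f x + f y) \<and>
     (\<forall>c. \<forall>x\<in>cvecs n. f (vscale c x) = c * f x)"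

definition semilinear_functional :: "nat \<Rightarrow> (cvec \<Rightarrow> complex) \<Rightarrow> bool" where
  "semilinear_functional n f \<longleftrightarrow>
     (\<forall>x\<in>cvecs n. \<forall>y\<in>cvecs n. f (vadd x y) = f x + f y) \<and>
     (\<forall>c. \<forall>x\<in>cvecs n. f (vscale c x) = cnj c * f x)"

definition bilinear_form :: "nat \<Rightarrow> nat \<Rightarrow> (cvec \<Rightarrow> cvec \<Rightarrow> complex) \<Rightarrow> bool" where
  "bilinear_form p q F \<longleftrightarrow>
     (\<forall>v\<in>cvecs q. linear_functional p (\<lambda>u. F u v)) \<and>
     (\<forall>u\<in>cvecs p. linear_functional q (\<lambda>v. F u v))"

definition sesquilinear_form :: "nat \<Rightarrow> nat \<Rightarrow> (cvec \<Rightarrow> cvec \<Rightarrow> complex) \<Rightarrow> bool" where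
  "sesquilinear_form p q F \<longleftrightarrow>
     (\<forall>v\<in>cvecs q. linear_functional p (\<lambda>u. F u v)) \<and>
     (\<forall>u\<in>cvecs p. semilinear_functional q (\<lambda>v. F u v))"

definition linear_bijection :: "nat \<Rightarrow> nat \<Rightarrow> (cvec \<Rightarrow> cvec) \<Rightarrow> bool" where
  "linear_bijection p q f \<longleftrightarrow>
     bij_betw f (cvecs p) (cvecs q) \<and>
     (\<forall>x\<in>cvecs p. \<forall>y\<in>cvecs p. f (vadd x y) = vadd (f x) (f y)) \<and>
     (\<forall>c. \<forall>x\<in>cvecs p. f (vscale c x) = vscale c (f x))"

text \<open>
  Edges are abstract objects, so multiple edges and loops are allowed. A directed edge goes from its
  source to its target. An undirected edge has no direction; its two ends \<open>i \<le> j\<close> are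
  recorded as source \<open>i\<close> and target \<open>j\<close>, which is the order of the arguments of its form.
\<close>

record 'e mixed_graph =
  num_vertices :: nat
  undirected_edges :: "'e set"
  directed_edges :: "'e set"
  source :: "'e \<Rightarrow> nat"
  target :: "'e \<Rightarrow> nat"

definition vertices :: "'e mixed_graph \<Rightarrow> nat set" where
  "vertices G = {1..num_vertices G}"

definition edges :: "'e mixed_graph \<Rightarrow> 'e set" where
  "edges G = undirected_edges G \<union> directed_edges G"

definition mixed_graph :: "'e mixed_graph \<Rightarrow> bool" where
  "mixed_graph G \<longleftrightarrow>
     undirected_edges G \<inter> directed_edges G = {} \<and>
     (\<forall>e\<in>edges G. source G e \<in> vertices G \<and> target G e \<in> vertices G) \<and>
     (\<forall>e\<in>undirected_edges G. source G e \<le> target G e)"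

text \<open>
  A dimension is a function on all natural numbers, but only its values at vertices matter;
  likewise forms and isomorphisms are constrained only at edges, at vertices and on the carriers.
\<close>

definition form_representation ::
    "'e mixed_graph \<Rightarrow> (nat \<Rightarrow> nat) \<Rightarrow> ('e \<Rightarrow> cvec \<Rightarrow> cvec \<Rightarrow> complex) \<Rightarrow> bool" where
  "form_representation G n A \<longleftrightarrow>
     (\<forall>e\<in>undirected_edges G. bilinear_form (n (source G e)) (n (target G e)) (A e)) \<and>
     (\<forall>e\<in>directed_edges G. sesquilinear_form (n (source G e)) (n (target G e)) (A e))"

definition preserves_forms ::
    "'e mixed_graph \<Rightarrow> (nat \<Rightarrow> nat) \<Rightarrow> ('e \<Rightarrow> cvec \<Rightarrow> cvec \<Rightarrow> complex) \<Rightarrow>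
     ('e \<Rightarrow> cvec \<Rightarrow> cvec \<Rightarrow> complex) \<Rightarrow> (nat \<Rightarrow> cvec \<Rightarrow> cvec) \<Rightarrow> bool" where
  "preserves_forms G n A B \<phi> \<longleftrightarrow>
     (\<forall>e\<in>edges G. \<forall>u\<in>cvecs (n (source G e)). \<forall>v\<in>cvecs (n (target G e)).
        A e u v = B e (\<phi> (source G e) u) (\<phi> (target G e) v))"

definition topologically_isomorphic ::
    "'e mixed_graph \<Rightarrow> (nat \<Rightarrow> nat) \<Rightarrow> ('e \<Rightarrow> cvec \<Rightarrow> cvec \<Rightarrow> complex) \<Rightarrow>
     (nat \<Rightarrow> nat) \<Rightarrow> ('e \<Rightarrow> cvec \<Rightarrow> cvec \<Rightarrow> complex) \<Rightarrow> bool" where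
  "topologically_isomorphic G n A m B \<longleftrightarrow>
     (\<exists>\<phi>. (\<forall>i\<in>vertices G. homeomorphic_map (cspace (n i)) (cspace (m i)) (\<phi> i)) \<and>
          preserves_forms G n A B \<phi>)"

definition linearly_isomorphic ::
    "'e mixed_graph \<Rightarrow> (nat \<Rightarrow> nat) \<Rightarrow> ('e \<Rightarrow> cvec \<Rightarrow> cvec \<Rightarrow> complex) \<Rightarrow>
     (nat \<Rightarrow> nat) \<Rightarrow> ('e \<Rightarrow> cvec \<Rightarrow> cvec \<Rightarrow> complex) \<Rightarrow> bool" where
  "linearly_isomorphic G n A m B \<longleftrightarrow>
     (\<exists>\<phi>. (\<forall>i\<in>vertices G. linear_bijection (n i) (m i) (\<phi> i)) \<and>
          preserves_forms G n A B \<phi>)"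

end

theory Submission
  imports Defs "HOL-Library.Function_Algebras" "HOL-Homology.Invariance_of_Domain"
begin

text \<open>
  A family of bijections that preserves all the forms is already linear wherever the forms can see it.
  If \<open>\<alpha>\<close> is an edge from \<open>i\<close> to \<open>j\<close>, then
  \<open>B\<^sub>\<alpha> (\<phi>\<^sub>i (x + y), \<phi>\<^sub>j v) = A\<^sub>\<alpha> (x + y, v) = A\<^sub>\<alpha> (x, v) + A\<^sub>\<alpha> (y, v) = B\<^sub>\<alpha> (\<phi>\<^sub>i x + \<phi>\<^sub>i y, \<phi>\<^sub>j v)\<close>,
  and \<open>\<phi>\<^sub>j v\<close> ranges over the whole space. Hence \<open>\<phi>\<^sub>i (x + y)\<close> and \<open>\<phi>\<^sub>i x + \<phi>\<^sub>i y\<close> differ by an element of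
  the radical at \<open>i\<close>, the vectors that every form of \<open>B\<close> annihilates in every slot belonging to \<open>i\<close>. The
  same computation works for scalar multiples and for the other slot. In the conjugate linear slot of a
  directed edge both sides acquire the same factor \<open>cnj c\<close>, so there too \<open>\<phi>\<^sub>i (c x)\<close> agrees with \<open>c \<phi>\<^sub>i x\<close>,
  not with \<open>cnj c\<close> times it. This is \<open>preserves_forms_linear_modulo_radical\<close>.

  It remains to replace \<open>\<phi>\<^sub>i\<close> by a linear bijection in the same class modulo the radical; the forms do not
  notice the change (\<open>form_congruent_modulo_radical\<close>). The linear isomorphism induced by \<open>\<phi>\<^sub>i\<close> on the quotients
  lifts to a linear bijection exactly when the two ambient dimensions agree
  (\<open>linear_bijection_congruent_modulo\<close>). That agreement is the one place where topology enters: \<open>\<phi>\<^sub>i\<close> is a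
  homeomorphism, so \<open>n\<^sub>i = m\<^sub>i\<close> by invariance of dimension (\<open>homeomorphic_map_cspace_imp_eq\<close>). Without
  continuity it would fail, as \<open>\<complex>\<close> and \<open>\<complex>\<^sup>2\<close> with zero forms show.

  Conversely, linear bijections between the spaces \<open>\<complex>\<^sup>n\<close> are homeomorphisms.
\<close>

section \<open>Lifting a map that is linear modulo a subspace\<close>

text \<open>
  The map \<open>f\<close> induces a linear isomorphism from \<open>V / K\<close> to \<open>V / R\<close>, where \<open>K\<close> is the preimage of \<open>R\<close>.
  A basis \<open>S\<close> of \<open>K\<close> extends by a set \<open>T\<close> to a basis of \<open>V\<close>. Following \<open>f\<close> on \<open>T\<close> and any injection of
  \<open>S\<close> into a basis \<open>S'\<close> of \<open>R\<close> on \<open>S\<close> gives the required map. Such an injection exists because the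
  images of \<open>T\<close> together with \<open>S'\<close> span \<open>V\<close>, whence \<open>card S + card T \<le> card T + card S'\<close>; finiteness of
  the dimension is used to cancel \<open>card T\<close> and, at the end, to pass from injective to surjective.
\<close>

lemma (in vector_space) linear_bijection_congruent_modulo:
  assumes V: "subspace V" and F: "finite F" "V \<subseteq> span F"
    and R: "subspace R" "R \<subseteq> V"
    and surj: "f ` V = V"
    and add: "\<And>x y. x \<in> V \<Longrightarrow> y \<in> V \<Longrightarrow> f (x + y) - (f x + f y) \<in> R"
    and scale: "\<And>c x. x \<in> V \<Longrightarrow> f (scale c x) - scale c (f x) \<in> R"
  obtains g where "Vector_Spaces.linear scale scale g" "bij_betw g V V"
    "\<And>x. x \<in> V \<Longrightarrow> g x - f x \<in> R"
proof -
  interpret vector_space_pair scale scale ..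
  have trans: "a - c \<in> R" if "a - b \<in> R" "b - c \<in> R" for a b c
    using subspace_add[OF R(1) that] by simp
  have swap: "b - a \<in> R" if "a - b \<in> R" for a b
    using subspace_neg[OF R(1) that] by simp
  define K where "K = {x \<in> V. f x \<in> R}"
  have f0: "f 0 \<in> R"
    using scale[of 0 0] subspace_0[OF V] by simp
  have K: "subspace K"
  proof (rule subspaceI)
    show "0 \<in> K" using f0 subspace_0[OF V] by (simp add: K_def)
  next
    fix x y assume xy: "x \<in> K" "y \<in> K"
    then have "(f (x + y) - (f x + f y)) + (f x + f y) \<in> R"
      by (intro subspace_add[OF R(1)] add) (auto simp: K_def)
    then show "x + y \<in> K"
      using xy by (simp add: K_def subspace_add[OF V])
  next
    fix c x assume x: "x \<in> K"
    then have "(f (scale c x) - scale c (f x)) + scale c (f x) \<in> R"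
      by (intro subspace_add[OF R(1)] scale subspace_scale[OF R(1)]) (auto simp: K_def)
    then show "scale c x \<in> K"
      using x by (simp add: K_def subspace_scale[OF V])
  qed
  obtain S where S: "S \<subseteq> K" "independent S" "K \<subseteq> span S"
    using maximal_independent_subset[of K] by blast
  have "S \<subseteq> V" using S(1) by (auto simp: K_def)
  then obtain B where B: "S \<subseteq> B" "B \<subseteq> V" "independent B" "V \<subseteq> span B"
    using maximal_independent_subset_extend[OF _ S(2)] by metis
  define T where "T = B - S"
  have spanB: "span B = V"
    using B V by (simp add: span_subspace)
  obtain S' where S': "S' \<subseteq> R" "independent S'" "R \<subseteq> span S'"
    using maximal_independent_subset[of R] by blast
  have finB: "finite B"
    using independent_span_bound[OF F(1) B(3)] B(2) F(2) by blast
  have finS': "finite S'"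
    using independent_span_bound[OF F(1) S'(2)] S'(1) R(2) F(2) by blast
  have finS: "finite S" and finT: "finite T"
    using finB B(1) by (auto simp: T_def intro: finite_subset)
  have split: "\<exists>s t. s \<in> span S \<and> t \<in> span T \<and> x = s + t" if "x \<in> V" for x
  proof -
    have "x \<in> span (S \<union> T)"
      using that spanB B(1) by (simp add: T_def Un_absorb1)
    then show ?thesis by (auto simp: span_Un)
  qed
  have SV: "span S \<subseteq> K" by (rule span_minimal[OF S(1) K])
  have TV: "span T \<subseteq> V" using spanB span_mono[of T B] by (auto simp: T_def)
  \<comment> \<open>Congruence to \<open>f\<close> need only be checked on the basis.\<close>
  have cong: "k x - f x \<in> R"
    if k: "Vector_Spaces.linear scale scale k" "\<And>b. b \<in> B \<Longrightarrow> k b - f b \<in> R" and x: "x \<in> V" for k x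
  proof -
    interpret k: Vector_Spaces.linear scale scale k by (rule k(1))
    have "x \<in> span B" using x spanB by simp
    then have "x \<in> V \<and> k x - f x \<in> R"
    proof (induction rule: span_induct_alt)
      case base
      then show ?case using f0 subspace_0[OF V] subspace_neg[OF R(1)] by (simp add: k.zero)
    next
      case (step c b y)
      have b: "b \<in> V" using step(1) B(2) by auto
      then have cb: "scale c b \<in> V" by (rule subspace_scale[OF V])
      have "scale c (k b - f b) + (k y - f y) \<in> R"
        using subspace_add[OF R(1) subspace_scale[OF R(1) k(2)[OF step(1)]]] step(2) by blast
      then have 1: "k (scale c b + y) - (scale c (f b) + f y) \<in> R"
        by (simp add: k.add k.scale scale_right_diff_distrib algebra_simps)
      have 2: "(scale c (f b) + f y) - (f (scale c b) + f y) \<in> R"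
        using swap[OF scale[OF b, of c]] by simp
      have 3: "(f (scale c b) + f y) - f (scale c b + y) \<in> R"
        using swap[OF add[OF cb, of y]] step by simp
      show ?case
        using trans[OF trans[OF 1 2] 3] subspace_add[OF V cb, of y] step by blast
    qed
    then show ?thesis by blast
  qed
  have "card S \<le> card S'"
  proof -
    obtain h where h: "Vector_Spaces.linear scale scale h" "\<And>b. b \<in> B \<Longrightarrow> h b = f b"
      using linear_independent_extend[OF B(3), of f] by blast
    interpret h: Vector_Spaces.linear scale scale h by (rule h(1))
    have hf: "h x - f x \<in> R" if "x \<in> V" for x
      using cong[OF h(1) _ that] h(2) subspace_0[OF R(1)] by simp
    have "V \<subseteq> span (h ` T \<union> S')"
    proof
      fix w assume "w \<in> V"
      then obtain x where x: "x \<in> V" "w = f x" using surj by blast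
      then obtain s t where st: "s \<in> span S" "t \<in> span T" "x = s + t" using split by blast
      have "f s \<in> R" "s \<in> V" using st(1) SV by (auto simp: K_def)
      then have "h s \<in> R" using subspace_add[OF R(1) hf[of s], of "f s"] by simp
      then have "f x - h x + h s \<in> R"
        by (rule subspace_add[OF R(1) swap[OF hf[OF x(1)]]])
      moreover have "f x - h x + h s = w - h t" using x(2) st(3) by (simp add: h.add)
      ultimately have "w - h t \<in> R" by simp
      then have "w - h t \<in> span S'" using S'(3) by blast
      moreover have "h t \<in> span (h ` T)" using st(2) h.span_image[of T] by blast
      ultimately have "h t + (w - h t) \<in> span (h ` T \<union> S')"
        using span_mono[of "h ` T" "h ` T \<union> S'"] span_mono[of S' "h ` T \<union> S'"]
        by (intro span_add) auto
      then show "w \<in> span (h ` T \<union> S')" by simp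
    qed
    then have "card B \<le> card (h ` T \<union> S')"
      using independent_span_bound[OF _ B(3), of "h ` T \<union> S'"] B(2) finT finS' by blast
    also have "\<dots> \<le> card T + card S'"
      using card_Un_le[of "h ` T" S'] card_image_le[OF finT, of h] by linarith
    also have "card B = card S + card T"
      using finB B(1) by (simp add: T_def card_Diff_subset card_mono finite_subset)
    finally show ?thesis by simp
  qed
  then obtain p where p: "p ` S \<subseteq> S'" "inj_on p S"
    using card_le_inj[OF finS finS'] by blast
  obtain g where g: "Vector_Spaces.linear scale scale g"
      "\<And>b. b \<in> B \<Longrightarrow> g b = (if b \<in> S then p b else f b)"
    using linear_independent_extend[OF B(3), of "\<lambda>b. if b \<in> S then p b else f b"] by blast
  \<comment> \<open>The projection onto \<open>span T\<close> along \<open>span S\<close>; it shows that these two spans meet only in \<open>0\<close>.\<close>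
  obtain pr where pr: "Vector_Spaces.linear scale scale pr"
      "\<And>b. b \<in> B \<Longrightarrow> pr b = (if b \<in> S then 0 else b)"
    using linear_independent_extend[OF B(3), of "\<lambda>b. if b \<in> S then 0 else b"] by blast
  interpret g: Vector_Spaces.linear scale scale g by (rule g(1))
  have gf: "g x - f x \<in> R" if "x \<in> V" for x
  proof (rule cong[OF g(1) _ that])
    fix b assume "b \<in> B"
    then show "g b - f b \<in> R"
      using g(2)[of b] p(1) S(1) S'(1) subspace_0[OF R(1)] subspace_diff[OF R(1), of "p b" "f b"]
      by (cases "b \<in> S") (auto simp: K_def)
  qed
  have "inj_on g V"
    unfolding g.inj_on_iff_eq_0[OF V]
  proof (intro ballI impI)
    fix x assume x: "x \<in> V" "g x = 0"
    obtain s t where st: "s \<in> span S" "t \<in> span T" "x = s + t" using split[OF x(1)] by blast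
    \<comment> \<open>As \<open>g x = 0\<close> lies in \<open>R\<close>, so does \<open>f x\<close>; hence \<open>x\<close> lies in \<open>K\<close> and its component \<open>t\<close> vanishes.\<close>
    have "f x \<in> R" using swap[OF gf[OF x(1)]] x(2) by simp
    then have "x \<in> K" using x(1) by (simp add: K_def)
    then have "x - s \<in> K" using st(1) SV subspace_diff[OF K] by blast
    then have tS: "t \<in> span S" using S(3) st(3) by auto
    have "pr t = 0"
    proof (rule module_hom_eq_on_span[OF pr(1) module_hom_zero _ tS])
      show "pr b = 0" if "b \<in> S" for b
        using pr(2)[of b] B(1) that by auto
    qed
    moreover have "pr t = t"
    proof (rule module_hom_eq_on_span[OF pr(1) module_hom_ident _ st(2)])
      show "pr b = b" if "b \<in> T" for b
        using pr(2)[of b] that by (auto simp: T_def)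
    qed
    ultimately have xs: "x = s" using st(3) by simp
    have "g ` S = p ` S" using g(2) B(1) by (intro image_cong) auto
    then have "independent (g ` S)"
      using independent_mono[OF S'(2) p(1)] by simp
    moreover have "inj_on g S"
      using p(2) g(2) B(1) by (subst inj_on_cong[of S g p]) auto
    ultimately have "inj_on g (span S)" by (rule g.inj_on_span_independent_image)
    then show "x = 0"
      using st(1) x(2) xs by (simp add: g.inj_on_iff_eq_0)
  qed
  moreover have "g ` V = V"
  proof
    have "g x \<in> V" if "x \<in> V" for x
      using subspace_add[OF V, of "g x - f x" "f x"] gf[OF that] R(2) surj that by auto
    then show gV: "g ` V \<subseteq> V" by blast
    have indep: "independent (g ` B)"
      using g.independent_injective_image[OF B(3)] spanB \<open>inj_on g V\<close> by simp
    have card: "card (g ` B) = card B"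
      using card_image inj_on_subset[OF \<open>inj_on g V\<close> B(2)] by blast
    show "V \<subseteq> g ` V"
    proof (rule ccontr)
      assume "\<not> V \<subseteq> g ` V"
      then obtain w where w: "w \<in> V" "w \<notin> span (g ` B)"
        using g.span_image[of B] spanB by auto
      then have "independent (insert w (g ` B))"
        using indep by (simp add: independent_insertI)
      moreover have "insert w (g ` B) \<subseteq> span B"
        using w(1) gV B(2) spanB by auto
      ultimately have "card (insert w (g ` B)) \<le> card B"
        using independent_span_bound[OF finB] by blast
      moreover have "w \<notin> g ` B" using w(2) span_base by blast
      ultimately show False using card finB by simp
    qed
  qed
  ultimately show ?thesis
    using that[OF g(1) _ gf] by (simp add: bij_betw_def)
qed

section \<open>Linear algebra and topology of the spaces \<open>\<complex>\<^sup>n\<close>\<close>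

text \<open>
  Identifying \<open>vadd\<close> with pointwise addition of functions makes the abstract theory of vector spaces
  available. The ambient space of all sequences has infinite dimension; only the subspaces \<open>cvecs n\<close>
  are finitely spanned.
\<close>

lemma vadd_eq_plus: "vadd x y = x + y"
  by (simp add: vadd_def plus_fun_def)

interpretation cvec: vector_space vscale
  by standard (auto simp: vscale_def fun_eq_iff algebra_simps)

lemma subspace_cvecs: "cvec.subspace (cvecs n)"
  by (rule cvec.subspaceI) (auto simp: cvecs_def vscale_def)

definition unit_cvec :: "nat \<Rightarrow> cvec" where
  "unit_cvec i = (\<lambda>j. if j = i then 1 else 0)"

lemma unit_cvec_in_cvecs: "i < n \<Longrightarrow> unit_cvec i \<in> cvecs n"
  by (auto simp: unit_cvec_def cvecs_def)

lemma sum_cvec_apply: "(\<Sum>i\<in>I. (f i :: cvec)) k = (\<Sum>i\<in>I. f i k)"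
  by (induction I rule: infinite_finite_induct) auto

lemma cvec_expansion: "x \<in> cvecs n \<Longrightarrow> x = (\<Sum>i<n. vscale (x i) (unit_cvec i))"
  by (force simp: fun_eq_iff sum_cvec_apply vscale_def unit_cvec_def cvecs_def if_distrib
      sum.delta cong: if_cong)

lemma cvecs_subset_span: "cvecs n \<subseteq> cvec.span (unit_cvec ` {..<n})"
proof
  fix x assume "x \<in> cvecs n"
  moreover have "(\<Sum>i<n. vscale (x i) (unit_cvec i)) \<in> cvec.span (unit_cvec ` {..<n})"
    by (intro cvec.span_sum cvec.span_scale cvec.span_base) auto
  ultimately show "x \<in> cvec.span (unit_cvec ` {..<n})"
    using cvec_expansion by metis
qed

lemma continuous_map_cspace_coordinate: "continuous_map (cspace n) euclidean (\<lambda>x. x i)"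
  unfolding cspace_def
  by (intro continuous_map_from_subtopology continuous_map_product_projection) simp

lemma continuous_map_into_cspace:
  "continuous_map X (cspace n) f \<longleftrightarrow>
     (\<forall>k. continuous_map X euclidean (\<lambda>x. f x k)) \<and> f \<in> topspace X \<rightarrow> cvecs n"
  unfolding cspace_def continuous_map_in_subtopology continuous_map_componentwise_UNIV ..

lemma continuous_map_complex_mult_left:
  fixes f :: "'a \<Rightarrow> complex"
  shows "continuous_map X euclidean f \<Longrightarrow> continuous_map X euclidean (\<lambda>x. c * f x)"
  by (simp add: continuous_map_atin tendsto_mult)

text \<open>
  Real and imaginary parts are interleaved: the coordinates \<open>2 * i\<close> and \<open>2 * i + 1\<close> of the real vector
  are those of the \<open>i\<close>-th complex coordinate.
\<close>

lemma cspace_homeomorphic_Euclidean_space: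
  "cspace n homeomorphic_space Euclidean_space (2 * n)"
proof -
  define f :: "cvec \<Rightarrow> nat \<Rightarrow> real"
    where "f = (\<lambda>x k. if even k then Re (x (k div 2)) else Im (x (k div 2)))"
  define g :: "(nat \<Rightarrow> real) \<Rightarrow> cvec"
    where "g = (\<lambda>y i. Complex (y (2 * i)) (y (Suc (2 * i))))"
  have "continuous_map (cspace n) (Euclidean_space (2 * n)) f"
    unfolding Euclidean_space_def continuous_map_in_subtopology continuous_map_componentwise_UNIV
  proof (intro conjI allI)
    fix k
    have "continuous_map (cspace n) euclidean (\<lambda>x. Re (x (k div 2)))"
      using continuous_map_compose[OF continuous_map_cspace_coordinate, of euclidean Re n "k div 2"]
      by (simp add: o_def continuous_on_Re)
    moreover have "continuous_map (cspace n) euclidean (\<lambda>x. Im (x (k div 2)))"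
      using continuous_map_compose[OF continuous_map_cspace_coordinate, of euclidean Im n "k div 2"]
      by (simp add: o_def continuous_on_Im)
    ultimately show "continuous_map (cspace n) euclidean (\<lambda>x. f x k)"
      by (cases "even k") (simp_all add: f_def)
  qed (auto simp: f_def cvecs_def)
  moreover have "continuous_map (Euclidean_space (2 * n)) (cspace n) g"
    unfolding continuous_map_into_cspace
  proof (intro conjI allI)
    fix i
    have coord: "continuous_map (Euclidean_space (2 * n)) euclidean (\<lambda>y. complex_of_real (y k))" for k
    proof -
      have "continuous_map (Euclidean_space (2 * n)) euclidean (\<lambda>y. y k)"
        unfolding Euclidean_space_def
        by (intro continuous_map_from_subtopology continuous_map_product_projection) simp
      from continuous_map_compose[OF this, of euclidean complex_of_real] show ?thesis
        by (simp add: o_def continuous_on_of_real)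
    qed
    have "continuous_map (Euclidean_space (2 * n)) euclidean
        (\<lambda>y. complex_of_real (y (2 * i)) + \<i> * complex_of_real (y (Suc (2 * i))))"
      by (intro continuous_map_add continuous_map_complex_mult_left coord)
    then show "continuous_map (Euclidean_space (2 * n)) euclidean (\<lambda>y. g y i)"
      by (simp add: g_def Complex_eq)
  qed (auto simp: g_def cvecs_def topspace_Euclidean_space complex_eq_iff)
  moreover have "g (f x) = x" for x
    by (auto simp: f_def g_def fun_eq_iff complex_eq_iff)
  moreover have "f (g y) = y" for y
    by (auto simp: f_def g_def fun_eq_iff elim!: oddE)
  ultimately show ?thesis
    unfolding homeomorphic_space_def homeomorphic_maps_def by blast
qed

lemma homeomorphic_map_cspace_imp_eq:
  assumes "homeomorphic_map (cspace n) (cspace m) f"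
  shows "n = m"
proof -
  have "cspace n homeomorphic_space cspace m"
    using assms homeomorphic_map_imp_homeomorphic_space by blast
  then have "Euclidean_space (2 * n) homeomorphic_space Euclidean_space (2 * m)"
    by (meson cspace_homeomorphic_Euclidean_space homeomorphic_space_sym homeomorphic_space_trans)
  then show ?thesis
    by (simp add: invariance_of_dimension_Euclidean_space)
qed

text \<open>
  The expansion in the standard basis exhibits each coordinate of \<open>f x\<close> as a finite linear combination
  of coordinates of \<open>x\<close>.
\<close>

lemma linear_bijection_continuous:
  assumes "linear_bijection p q f"
  shows "continuous_map (cspace p) (cspace q) f"
proof -
  have bij: "bij_betw f (cvecs p) (cvecs q)"
    and add: "\<And>x y. x \<in> cvecs p \<Longrightarrow> y \<in> cvecs p \<Longrightarrow> f (x + y) = f x + f y"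
    and scale: "\<And>c x. x \<in> cvecs p \<Longrightarrow> f (vscale c x) = vscale c (f x)"
    using assms by (auto simp: linear_bijection_def vadd_eq_plus)
  have f0: "f 0 = 0"
    using scale[of 0 0] cvec.subspace_0[OF subspace_cvecs] by simp
  have expand: "f x = (\<Sum>i<p. vscale (x i) (f (unit_cvec i)))" if x: "x \<in> cvecs p" for x
  proof -
    have "f (\<Sum>i\<in>I. vscale (x i) (unit_cvec i)) = (\<Sum>i\<in>I. vscale (x i) (f (unit_cvec i)))"
      if "finite I" "I \<subseteq> {..<p}" for I
      using that
    proof (induction I)
      case (insert i I)
      have "vscale (x j) (unit_cvec j) \<in> cvecs p" if "j \<in> insert i I" for j
        using that insert.prems
        by (intro cvec.subspace_scale[OF subspace_cvecs] unit_cvec_in_cvecs) auto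
      then have "f (vscale (x i) (unit_cvec i) + (\<Sum>j\<in>I. vscale (x j) (unit_cvec j))) =
          f (vscale (x i) (unit_cvec i)) + f (\<Sum>j\<in>I. vscale (x j) (unit_cvec j))"
        by (intro add cvec.subspace_sum[OF subspace_cvecs]) auto
      also have "f (vscale (x i) (unit_cvec i)) = vscale (x i) (f (unit_cvec i))"
        using insert.prems by (intro scale unit_cvec_in_cvecs) auto
      also have "f (\<Sum>j\<in>I. vscale (x j) (unit_cvec j)) = (\<Sum>j\<in>I. vscale (x j) (f (unit_cvec j)))"
        using insert.IH insert.prems by blast
      finally show ?case
        unfolding sum.insert[OF insert.hyps] .
    qed (simp add: f0)
    from this[of "{..<p}"] show ?thesis
      using cvec_expansion[OF x] by simp
  qed
  show ?thesis
    unfolding continuous_map_into_cspace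
  proof (intro conjI allI)
    fix k
    have "continuous_map (cspace p) euclidean (\<lambda>x. \<Sum>i<p. f (unit_cvec i) k * x i)"
      by (intro continuous_map_sum continuous_map_complex_mult_left continuous_map_cspace_coordinate) auto
    then show "continuous_map (cspace p) euclidean (\<lambda>x. f x k)"
      by (rule continuous_map_eq) (simp add: expand sum_cvec_apply vscale_def mult.commute)
  qed (use bij in \<open>auto simp: bij_betw_def\<close>)
qed

lemma linear_bijection_inv_into:
  assumes "linear_bijection p q f"
  shows "linear_bijection q p (inv_into (cvecs p) f)"
proof -
  let ?g = "inv_into (cvecs p) f"
  have bij: "bij_betw f (cvecs p) (cvecs q)"
    and add: "\<And>x y. x \<in> cvecs p \<Longrightarrow> y \<in> cvecs p \<Longrightarrow> f (x + y) = f x + f y"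
    and scale: "\<And>c x. x \<in> cvecs p \<Longrightarrow> f (vscale c x) = vscale c (f x)"
    using assms by (auto simp: linear_bijection_def vadd_eq_plus)
  have gf: "?g (f x) = x" if "x \<in> cvecs p" for x
    using that bij bij_betw_inv_into_left by metis
  have ex: "\<exists>x\<in>cvecs p. y = f x" if "y \<in> cvecs q" for y
    using that bij by (auto simp: bij_betw_def)
  have "?g (y + z) = ?g y + ?g z" if "y \<in> cvecs q" "z \<in> cvecs q" for y z
    using ex[OF that(1)] ex[OF that(2)]
    by (metis add gf cvec.subspace_add[OF subspace_cvecs])
  moreover have "?g (vscale c y) = vscale c (?g y)" if "y \<in> cvecs q" for c y
    using ex[OF that] by (metis scale gf cvec.subspace_scale[OF subspace_cvecs])
  ultimately show ?thesis
    using bij by (simp add: linear_bijection_def vadd_eq_plus bij_betw_inv_into)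
qed

lemma linear_bijection_homeomorphic_map:
  assumes "linear_bijection p q f"
  shows "homeomorphic_map (cspace p) (cspace q) f"
proof -
  have "bij_betw f (cvecs p) (cvecs q)"
    using assms by (simp add: linear_bijection_def)
  then have "homeomorphic_maps (cspace p) (cspace q) f (inv_into (cvecs p) f)"
    using linear_bijection_continuous[OF assms]
      linear_bijection_continuous[OF linear_bijection_inv_into[OF assms]]
    by (simp add: homeomorphic_maps_def bij_betw_inv_into_left bij_betw_inv_into_right)
  then show ?thesis
    by (simp add: homeomorphic_maps_map)
qed

section \<open>Forms and their common radical\<close>

text \<open>
  One notion covers both kinds of edges: \<open>\<sigma> = id\<close> gives the bilinear and \<open>\<sigma> = cnj\<close> the sesquilinear
  forms. The twist \<open>\<sigma>\<close> depends on the edge alone, so it is the same for both representations and cancels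
  when their forms are compared.
\<close>

definition twisted_bilinear ::
    "(complex \<Rightarrow> complex) \<Rightarrow> nat \<Rightarrow> nat \<Rightarrow> (cvec \<Rightarrow> cvec \<Rightarrow> complex) \<Rightarrow> bool" where
  "twisted_bilinear \<sigma> p q F \<longleftrightarrow>
     (\<forall>u\<in>cvecs p. \<forall>u'\<in>cvecs p. \<forall>v\<in>cvecs q. F (u + u') v = F u v + F u' v) \<and>
     (\<forall>u\<in>cvecs p. \<forall>v\<in>cvecs q. \<forall>v'\<in>cvecs q. F u (v + v') = F u v + F u v') \<and>
     (\<forall>c. \<forall>u\<in>cvecs p. \<forall>v\<in>cvecs q. F (vscale c u) v = c * F u v) \<and>
     (\<forall>c. \<forall>u\<in>cvecs p. \<forall>v\<in>cvecs q. F u (vscale c v) = \<sigma> c * F u v)"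

lemma twisted_bilinear_diff:
  assumes "twisted_bilinear \<sigma> p q F"
  shows "u \<in> cvecs p \<Longrightarrow> u' \<in> cvecs p \<Longrightarrow> v \<in> cvecs q \<Longrightarrow> F (u - u') v = F u v - F u' v"
    and "u \<in> cvecs p \<Longrightarrow> v \<in> cvecs q \<Longrightarrow> v' \<in> cvecs q \<Longrightarrow> F u (v - v') = F u v - F u v'"
proof -
  assume "u \<in> cvecs p" "u' \<in> cvecs p" "v \<in> cvecs q"
  moreover from this have "F (u - u' + u') v = F (u - u') v + F u' v"
    using assms cvec.subspace_diff[OF subspace_cvecs] unfolding twisted_bilinear_def by blast
  ultimately show "F (u - u') v = F u v - F u' v" by simp
next
  assume "u \<in> cvecs p" "v \<in> cvecs q" "v' \<in> cvecs q"
  moreover from this have "F u (v - v' + v') = F u (v - v') + F u v'"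
    using assms cvec.subspace_diff[OF subspace_cvecs] unfolding twisted_bilinear_def by blast
  ultimately show "F u (v - v') = F u v - F u v'" by simp
qed

definition edge_twist :: "'e mixed_graph \<Rightarrow> 'e \<Rightarrow> complex \<Rightarrow> complex" where
  "edge_twist G e = (if e \<in> directed_edges G then cnj else id)"

lemma form_representation_twisted_bilinear:
  assumes "mixed_graph G" "form_representation G m B" "e \<in> edges G"
  shows "twisted_bilinear (edge_twist G e) (m (source G e)) (m (target G e)) (B e)"
proof (cases "e \<in> directed_edges G")
  case True
  then have "sesquilinear_form (m (source G e)) (m (target G e)) (B e)"
    using assms(2) by (simp add: form_representation_def)
  then show ?thesis
    using True
    by (simp add: twisted_bilinear_def edge_twist_def sesquilinear_form_def linear_functional_def
        semilinear_functional_def vadd_eq_plus)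
next
  case False
  then have "bilinear_form (m (source G e)) (m (target G e)) (B e)"
    using assms(2,3) by (simp add: form_representation_def edges_def)
  then show ?thesis
    using False
    by (simp add: twisted_bilinear_def edge_twist_def bilinear_form_def linear_functional_def
        vadd_eq_plus)
qed

text \<open>
  A loop at \<open>i\<close> contributes both of its slots, and an isolated vertex has its whole space as radical.
\<close>

definition radical ::
    "'e mixed_graph \<Rightarrow> (nat \<Rightarrow> nat) \<Rightarrow> ('e \<Rightarrow> cvec \<Rightarrow> cvec \<Rightarrow> complex) \<Rightarrow> nat \<Rightarrow> cvec set" where
  "radical G m B i = {w \<in> cvecs (m i). \<forall>e\<in>edges G.
     (source G e = i \<longrightarrow> (\<forall>v\<in>cvecs (m (target G e)). B e w v = 0)) \<and>
     (target G e = i \<longrightarrow> (\<forall>u\<in>cvecs (m (source G e)). B e u w = 0))}"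

lemma subspace_radical:
  assumes "mixed_graph G" "form_representation G m B"
  shows "cvec.subspace (radical G m B i)"
proof (rule cvec.subspaceI)
  have zero: "(0::cvec) \<in> cvecs k" for k
    by (rule cvec.subspace_0[OF subspace_cvecs])
  have "B e 0 v = 0" if "e \<in> edges G" "v \<in> cvecs (m (target G e))" for e v
    using twisted_bilinear_diff(1)[OF form_representation_twisted_bilinear[OF assms that(1)]
        zero zero that(2)] by simp
  moreover have "B e u 0 = 0" if "e \<in> edges G" "u \<in> cvecs (m (source G e))" for e u
    using twisted_bilinear_diff(2)[OF form_representation_twisted_bilinear[OF assms that(1)]
        that(2) zero zero] by simp
  ultimately show "0 \<in> radical G m B i"
    using zero by (auto simp: radical_def)
next
  fix x y assume "x \<in> radical G m B i" "y \<in> radical G m B i"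
  then show "x + y \<in> radical G m B i"
    using form_representation_twisted_bilinear[OF assms] cvec.subspace_add[OF subspace_cvecs]
    by (auto simp: radical_def twisted_bilinear_def)
next
  fix c x assume "x \<in> radical G m B i"
  then show "vscale c x \<in> radical G m B i"
    using form_representation_twisted_bilinear[OF assms] cvec.subspace_scale[OF subspace_cvecs]
    by (auto simp: radical_def twisted_bilinear_def)
qed

lemma form_congruent_modulo_radical:
  assumes "mixed_graph G" "form_representation G m B" "e \<in> edges G"
    and u: "u \<in> cvecs (m (source G e))" "u' \<in> cvecs (m (source G e))"
      "u' - u \<in> radical G m B (source G e)"
    and v: "v \<in> cvecs (m (target G e))" "v' \<in> cvecs (m (target G e))"
      "v' - v \<in> radical G m B (target G e)"
  shows "B e u' v' = B e u v"
proof -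
  note F = form_representation_twisted_bilinear[OF assms(1-3)]
  have "B e (u' - u) v' = 0" "B e u (v' - v) = 0"
    using assms(3) u v by (auto simp: radical_def)
  then show ?thesis
    using twisted_bilinear_diff(1)[OF F u(2,1) v(2)] twisted_bilinear_diff(2)[OF F u(1) v(2,1)]
    by simp
qed

text \<open>
  Since every \<open>\<phi> j\<close> is onto, membership in the radical can be tested against vectors of the form
  \<open>\<phi> j v\<close> (the fact \<open>test\<close> in the proof), and on such vectors the forms of \<open>B\<close> are those of \<open>A\<close>, where
  linearity in the argument \<open>x\<close> is available.
\<close>

lemma preserves_forms_linear_modulo_radical:
  assumes G: "mixed_graph G" and A: "form_representation G n A" and B: "form_representation G m B"
    and onto: "\<And>j. j \<in> vertices G \<Longrightarrow> \<phi> j ` cvecs (n j) = cvecs (m j)"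
    and pres: "preserves_forms G n A B \<phi>"
    and i: "i \<in> vertices G" and x: "x \<in> cvecs (n i)"
  shows "y \<in> cvecs (n i) \<Longrightarrow> \<phi> i (x + y) - (\<phi> i x + \<phi> i y) \<in> radical G m B i"
    and "\<phi> i (vscale c x) - vscale c (\<phi> i x) \<in> radical G m B i"
proof -
  have mem: "\<phi> j u \<in> cvecs (m j)" if "j \<in> vertices G" "u \<in> cvecs (n j)" for j u
    using onto that by blast
  have ends: "source G e \<in> vertices G" "target G e \<in> vertices G" if "e \<in> edges G" for e
    using G that by (auto simp: mixed_graph_def)
  have AB: "B e (\<phi> (source G e) u) (\<phi> (target G e) v) = A e u v"
    if "e \<in> edges G" "u \<in> cvecs (n (source G e))" "v \<in> cvecs (n (target G e))" for e u v
    using pres that by (simp add: preserves_forms_def)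
  note twA = form_representation_twisted_bilinear[OF G A, unfolded twisted_bilinear_def]
  note twB = form_representation_twisted_bilinear[OF G B, unfolded twisted_bilinear_def]
  have test: "a - b \<in> radical G m B i"
    if ab: "a \<in> cvecs (m i)" "b \<in> cvecs (m i)"
      and l: "\<And>e v. e \<in> edges G \<Longrightarrow> source G e = i \<Longrightarrow> v \<in> cvecs (n (target G e)) \<Longrightarrow>
        B e a (\<phi> (target G e) v) = B e b (\<phi> (target G e) v)"
      and r: "\<And>e u. e \<in> edges G \<Longrightarrow> target G e = i \<Longrightarrow> u \<in> cvecs (n (source G e)) \<Longrightarrow>
        B e (\<phi> (source G e) u) a = B e (\<phi> (source G e) u) b"
    for a b
    unfolding radical_def
  proof (intro CollectI conjI ballI impI)
    show "a - b \<in> cvecs (m i)" using ab by (rule cvec.subspace_diff[OF subspace_cvecs])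
  next
    fix e v assume e: "e \<in> edges G" "source G e = i" and v: "v \<in> cvecs (m (target G e))"
    obtain v0 where "v0 \<in> cvecs (n (target G e))" "v = \<phi> (target G e) v0"
      using v onto[OF ends(2)[OF e(1)]] by blast
    then show "B e (a - b) v = 0"
      using twisted_bilinear_diff(1)[OF form_representation_twisted_bilinear[OF G B e(1)], of a b v]
        l[OF e] ab e(2) v by simp
  next
    fix e u assume e: "e \<in> edges G" "target G e = i" and u: "u \<in> cvecs (m (source G e))"
    obtain u0 where "u0 \<in> cvecs (n (source G e))" "u = \<phi> (source G e) u0"
      using u onto[OF ends(1)[OF e(1)]] by blast
    then show "B e u (a - b) = 0"
      using twisted_bilinear_diff(2)[OF form_representation_twisted_bilinear[OF G B e(1)], of u a b]
        r[OF e] ab e(2) u by simp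
  qed
  {
    assume y: "y \<in> cvecs (n i)"
    have xy: "x + y \<in> cvecs (n i)" using x y by (rule cvec.subspace_add[OF subspace_cvecs])
    show "\<phi> i (x + y) - (\<phi> i x + \<phi> i y) \<in> radical G m B i"
    proof (rule test)
      show "\<phi> i (x + y) \<in> cvecs (m i)" "\<phi> i x + \<phi> i y \<in> cvecs (m i)"
        using i x y xy by (auto intro!: mem cvec.subspace_add[OF subspace_cvecs])
    next
      fix e v assume e: "e \<in> edges G" "source G e = i" and v: "v \<in> cvecs (n (target G e))"
      have "B e (\<phi> i x + \<phi> i y) (\<phi> (target G e) v) = A e x v + A e y v"
        using twB[OF e(1)] AB[OF e(1)] e ends[OF e(1)] x y v mem by force
      then show "B e (\<phi> i (x + y)) (\<phi> (target G e) v) = B e (\<phi> i x + \<phi> i y) (\<phi> (target G e) v)"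
        using twA[OF e(1)] AB[OF e(1)] e x y xy v by force
    next
      fix e u assume e: "e \<in> edges G" "target G e = i" and u: "u \<in> cvecs (n (source G e))"
      have "B e (\<phi> (source G e) u) (\<phi> i x + \<phi> i y) = A e u x + A e u y"
        using twB[OF e(1)] AB[OF e(1)] e ends[OF e(1)] x y u mem by force
      then show "B e (\<phi> (source G e) u) (\<phi> i (x + y)) = B e (\<phi> (source G e) u) (\<phi> i x + \<phi> i y)"
        using twA[OF e(1)] AB[OF e(1)] e x y xy u by force
    qed
  }
  have cx: "vscale c x \<in> cvecs (n i)" using x by (rule cvec.subspace_scale[OF subspace_cvecs])
  show "\<phi> i (vscale c x) - vscale c (\<phi> i x) \<in> radical G m B i"
  proof (rule test)
    show "\<phi> i (vscale c x) \<in> cvecs (m i)" "vscale c (\<phi> i x) \<in> cvecs (m i)"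
      using i x cx by (auto intro!: mem cvec.subspace_scale[OF subspace_cvecs])
  next
    fix e v assume e: "e \<in> edges G" "source G e = i" and v: "v \<in> cvecs (n (target G e))"
    have "B e (vscale c (\<phi> i x)) (\<phi> (target G e) v) = c * A e x v"
      using twB[OF e(1)] AB[OF e(1)] e ends[OF e(1)] x v mem by force
    then show "B e (\<phi> i (vscale c x)) (\<phi> (target G e) v) = B e (vscale c (\<phi> i x)) (\<phi> (target G e) v)"
      using twA[OF e(1)] AB[OF e(1)] e x cx v by force
  next
    fix e u assume e: "e \<in> edges G" "target G e = i" and u: "u \<in> cvecs (n (source G e))"
    have "B e (\<phi> (source G e) u) (vscale c (\<phi> i x)) = edge_twist G e c * A e u x"
      using twB[OF e(1)] AB[OF e(1)] e ends[OF e(1)] x u mem by force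
    then show "B e (\<phi> (source G e) u) (\<phi> i (vscale c x)) = B e (\<phi> (source G e) u) (vscale c (\<phi> i x))"
      using twA[OF e(1)] AB[OF e(1)] e x cx u by force
  qed
qed

section \<open>Topological and linear isomorphism coincide\<close>

theorem mainTheorem1:
  fixes G :: "'e mixed_graph"
    and n m :: "nat \<Rightarrow> nat"
    and A B :: "'e \<Rightarrow> cvec \<Rightarrow> cvec \<Rightarrow> complex"
  assumes "mixed_graph G"
    and "form_representation G n A"
    and "form_representation G m B"
  shows "topologically_isomorphic G n A m B \<longleftrightarrow> linearly_isomorphic G n A m B"
proof
  assume "topologically_isomorphic G n A m B"
  then obtain \<phi> where hom: "\<And>i. i \<in> vertices G \<Longrightarrow> homeomorphic_map (cspace (n i)) (cspace (m i)) (\<phi> i)"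
    and pres: "preserves_forms G n A B \<phi>"
    by (auto simp: topologically_isomorphic_def)
  have onto: "\<phi> i ` cvecs (n i) = cvecs (m i)" if "i \<in> vertices G" for i
    using homeomorphic_imp_surjective_map[OF hom[OF that]] by simp
  have "\<exists>g. linear_bijection (n i) (m i) g \<and> (\<forall>x\<in>cvecs (n i). g x - \<phi> i x \<in> radical G m B i)"
    if i: "i \<in> vertices G" for i
  proof -
    have nm: "n i = m i"
      by (rule homeomorphic_map_cspace_imp_eq[OF hom[OF i]])
    note lin = preserves_forms_linear_modulo_radical[OF assms onto pres i]
    obtain g where g: "Vector_Spaces.linear vscale vscale g" "bij_betw g (cvecs (n i)) (cvecs (n i))"
      "\<And>x. x \<in> cvecs (n i) \<Longrightarrow> g x - \<phi> i x \<in> radical G m B i"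
    proof (rule cvec.linear_bijection_congruent_modulo)
      show "cvec.subspace (cvecs (n i))" by (rule subspace_cvecs)
      show "finite (unit_cvec ` {..<n i})" by simp
      show "cvecs (n i) \<subseteq> cvec.span (unit_cvec ` {..<n i})" by (rule cvecs_subset_span)
      show "cvec.subspace (radical G m B i)" by (rule subspace_radical[OF assms(1,3)])
      show "radical G m B i \<subseteq> cvecs (n i)" by (auto simp: radical_def nm)
      show "\<phi> i ` cvecs (n i) = cvecs (n i)" using onto[OF i] nm by simp
    qed (use lin in blast)+
    interpret g: Vector_Spaces.linear vscale vscale g by (rule g(1))
    have "linear_bijection (n i) (m i) g"
      using g(2) by (simp add: linear_bijection_def vadd_eq_plus g.add g.scale nm)
    then show ?thesis using g(3) by blast
  qed
  then obtain \<psi> where \<psi>: "\<And>i. i \<in> vertices G \<Longrightarrow> linear_bijection (n i) (m i) (\<psi> i)"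
    "\<And>i x. i \<in> vertices G \<Longrightarrow> x \<in> cvecs (n i) \<Longrightarrow> \<psi> i x - \<phi> i x \<in> radical G m B i"
    by metis
  have mem: "\<psi> i x \<in> cvecs (m i)" "\<phi> i x \<in> cvecs (m i)" if "i \<in> vertices G" "x \<in> cvecs (n i)" for i x
    using \<psi>(1)[OF that(1)] onto[OF that(1)] that(2) by (auto simp: linear_bijection_def bij_betw_def)
  have "preserves_forms G n A B \<psi>"
    unfolding preserves_forms_def
  proof (intro ballI)
    fix e u v
    assume e: "e \<in> edges G" and u: "u \<in> cvecs (n (source G e))" and v: "v \<in> cvecs (n (target G e))"
    have ends: "source G e \<in> vertices G" "target G e \<in> vertices G"
      using assms(1) e by (auto simp: mixed_graph_def)
    have "A e u v = B e (\<phi> (source G e) u) (\<phi> (target G e) v)"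
      using pres e u v by (simp add: preserves_forms_def)
    also have "\<dots> = B e (\<psi> (source G e) u) (\<psi> (target G e) v)"
      by (rule form_congruent_modulo_radical[OF assms(1,3) e, symmetric])
        (use ends u v mem \<psi>(2) in blast)+
    finally show "A e u v = B e (\<psi> (source G e) u) (\<psi> (target G e) v)" .
  qed
  then show "linearly_isomorphic G n A m B"
    using \<psi>(1) by (auto simp: linearly_isomorphic_def)
next
  assume "linearly_isomorphic G n A m B"
  then show "topologically_isomorphic G n A m B"
    by (auto simp: linearly_isomorphic_def topologically_isomorphic_def
        intro: linear_bijection_homeomorphic_map)
qed

end
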